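(* Let $a,b$ be row vectors of length $n$ with entries in $\mathbb{R}_{\max}$ and consider the closed half-space $H=\{h\in\mathbb{R}_{\max}^n\mid ah\geq bh\}$. Let $I=\operatorname{Supp} a$, $J=\operatorname{Supp} b$, and assume that $I\cap J=\emptyset$ and $J\neq\emptyset$. Then for any $x\in\mathbb{R}_{\max}^n$ we have $$P_H(x)=x\wedge\big(b\backslash (ax)\big),$$ i.e. $$(P_H(x))_j=\begin{cases}x_j & \text{for } j\in[n]\setminus J,\\ \min\big(x_j,\,-b_j+ax\big)=\min\big(x_j,\,-b_j+\max_{i\in I}(a_i+x_i)\big) & \text{for } j\in J.\end{cases}$$
   Context: $\mathbb{R}_{\max}=\mathbb{R}\cup\{-\infty\}$ with addition $\oplus=\max$ and multiplication $\otimes=+$; $[n]=\{1,\dots,n\}$. For a row vector $a$ and a column vector $h\in\mathbb{R}_{\max}^n$, $ah:=\max_{i\in[n]}(a_i+h_i)$. $\operatorname{Supp} a:=\{i\in[n]\mid a_i\in\mathbb{R}\}$. $\wedge$ denotes the entrywise minimum; a maximum over the empty set is $-\infty$. For a row vector $b$ and a scalar $\lambda\in\mathbb{R}_{\max}$, $b\backslash\lambda:=\sup\{u\in\mathbb{R}_{\max}^n\mid bu\leq\lambda\}$ is the column vector with entries $-b_j+\lambda$ if $j\in\operatorname{Supp} b$ and $+\infty$ if $j\notin\operatorname{Supp} b$. The canonical projection onto $H$ is $P_H(x):=\max\{h\in H\mid h\leq x\}$ (entrywise order; the supremum is attained). *)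

theory Defs
  imports "HOL-Library.Extended_Real"
begin

text \<open>
  Vectors of length \<open>n\<close>, both rows and columns, are functions from a finite index type into
  \<open>ereal\<close>, with the pointwise order and lattice operations. The residual of a row vector may have
  entries \<open>\<infinity>\<close>, so the ambient scalars are the extended reals, and membership in
  \<open>\<real>\<^sub>m\<^sub>a\<^sub>x = \<real> \<union> {-\<infinity>}\<close> is an explicit side condition. On
  \<open>\<real>\<^sub>m\<^sub>a\<^sub>x\<close> the extended-real addition satisfies \<open>-\<infinity> + r = -\<infinity>\<close>, as required.
\<close>

definition Rmax :: "ereal set" where
  "Rmax = insert (-\<infinity>) (range ereal)"

definition Rmax_vec :: "('n \<Rightarrow> ereal) set" where
  "Rmax_vec = {x. \<forall>i. x i \<in> Rmax}"

definition trop_dot :: "('n::finite \<Rightarrow> ereal) \<Rightarrow> ('n \<Rightarrow> ereal) \<Rightarrow> ereal"  (infixl \<open>\<odot>\<close> 70) where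
  "a \<odot> h = (SUP i. a i + h i)"

definition Supp :: "('n \<Rightarrow> ereal) \<Rightarrow> 'n set" where
  "Supp a = {i. a i \<in> range ereal}"

definition half_space :: "('n::finite \<Rightarrow> ereal) \<Rightarrow> ('n \<Rightarrow> ereal) \<Rightarrow> ('n \<Rightarrow> ereal) set" where
  "half_space a b = {h \<in> Rmax_vec. a \<odot> h \<ge> b \<odot> h}"

text \<open>The residual \<open>b \ \<lambda>\<close>; the supremum is taken over vectors in \<open>\<real>\<^sub>m\<^sub>a\<^sub>x\<^sup>n\<close> but
  computed among vectors of extended reals.\<close>

definition residual :: "('n::finite \<Rightarrow> ereal) \<Rightarrow> ereal \<Rightarrow> ('n \<Rightarrow> ereal)" where
  "residual b l = Sup {u \<in> Rmax_vec. b \<odot> u \<le> l}"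

definition proj :: "('n \<Rightarrow> ereal) set \<Rightarrow> ('n \<Rightarrow> ereal) \<Rightarrow> ('n \<Rightarrow> ereal)" where
  "proj H x = (GREATEST h. h \<in> H \<and> h \<le> x)"

lemma Rmax_iff: "r \<in> Rmax \<longleftrightarrow> r \<noteq> \<infinity>"
  unfolding Rmax_def by (cases r) auto

lemma Rmax_add_MInf: "r \<noteq> \<infinity> \<Longrightarrow> r + -\<infinity> = (-\<infinity> :: ereal)"
  by (cases r) auto

lemma Supp_iff: "a \<in> Rmax_vec \<Longrightarrow> i \<in> Supp a \<longleftrightarrow> a i \<noteq> -\<infinity>"
  unfolding Rmax_vec_def Supp_def Rmax_iff by (cases "a i") auto

lemma trop_dot_Sup:
  assumes a: "a \<in> Rmax_vec" and S: "S \<noteq> {}" "Sup S \<in> Rmax_vec"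
  shows "a \<odot> Sup S = (SUP h\<in>S. a \<odot> h)"
proof -
  have "a i + (Sup S) i = (SUP h\<in>S. a i + h i)" for i
  proof (cases "a i = -\<infinity>")
    case False
    then show ?thesis
      using S by (simp add: SUP_ereal_add_right)
  next
    case True
    have fin: "(Sup S) i \<noteq> \<infinity>"
      using S(2) by (auto simp: Rmax_vec_def Rmax_iff)
    have "h i \<noteq> \<infinity>" if "h \<in> S" for h
    proof -
      have "h i \<le> (Sup S) i"
        using that by (metis Sup_upper le_fun_def)
      then show ?thesis using fin by auto
    qed
    then have "(SUP h\<in>S. a i + h i) = (SUP h\<in>S. -\<infinity>)"
      using True by (intro SUP_cong) auto
    then show ?thesis using True fin S(1) by simp
  qed
  then show ?thesis
    unfolding trop_dot_def by (simp add: SUP_commute[of _ UNIV])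
qed

text \<open>Canonical projections onto half-spaces are well defined: the maximum exists.\<close>

lemma proj_half_space:
  assumes "a \<in> Rmax_vec" "b \<in> Rmax_vec" "x \<in> Rmax_vec"
  shows "proj (half_space a b) x \<in> half_space a b"
    and "proj (half_space a b) x \<le> x"
    and "\<And>h. h \<in> half_space a b \<Longrightarrow> h \<le> x \<Longrightarrow> h \<le> proj (half_space a b) x"
proof -
  define S where "S = {h \<in> half_space a b. h \<le> x}"
  have bot: "(\<lambda>_. -\<infinity>) \<in> S"
    using assms by (auto simp: S_def half_space_def Rmax_vec_def Rmax_iff trop_dot_def le_fun_def
        Rmax_add_MInf)
  have le: "Sup S \<le> x"
    by (rule Sup_least) (auto simp: S_def)
  have R: "Sup S \<in> Rmax_vec"
    unfolding Rmax_vec_def Rmax_iff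
  proof (intro CollectI allI)
    fix i
    have "(Sup S) i \<le> x i" "x i \<noteq> \<infinity>"
      using le assms(3) by (auto simp only: le_fun_def Rmax_vec_def Rmax_iff mem_Collect_eq)
    then show "(Sup S) i \<noteq> \<infinity>" by auto
  qed
  have ne: "S \<noteq> {}" using bot by auto
  have "b \<odot> Sup S \<le> a \<odot> Sup S"
    unfolding trop_dot_Sup[OF assms(1) ne R] trop_dot_Sup[OF assms(2) ne R]
    by (rule SUP_mono) (auto simp: S_def half_space_def)
  then have mem: "Sup S \<in> half_space a b"
    using R by (simp only: half_space_def mem_Collect_eq simp_thms)
  have up: "h \<le> Sup S" if "h \<in> half_space a b" "h \<le> x" for h
    using that by (intro Sup_upper) (auto simp: S_def)
  have eq: "proj (half_space a b) x = Sup S"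
    unfolding proj_def by (rule Greatest_equality) (use mem le up in blast)+
  show "proj (half_space a b) x \<in> half_space a b" "proj (half_space a b) x \<le> x"
    using mem le by (simp_all only: eq)
  show "h \<le> proj (half_space a b) x" if "h \<in> half_space a b" "h \<le> x" for h
    using up[OF that] by (simp only: eq)
qed

lemma residual_apply:
  assumes b: "b \<in> Rmax_vec" and l: "l \<in> Rmax"
  shows "residual b l j = (if j \<in> Supp b then - b j + l else \<infinity>)"
proof -
  let ?U = "{u \<in> Rmax_vec. b \<odot> u \<le> l}"
  have bf: "b i \<noteq> \<infinity>" for i using b by (auto simp: Rmax_vec_def Rmax_iff)
  have unit: "(\<lambda>i. if i = j then r else -\<infinity>) \<in> ?U" if "b j + r \<le> l" "r \<noteq> \<infinity>" for r
    using that bf by (auto simp: Rmax_vec_def Rmax_iff trop_dot_def Rmax_add_MInf intro!: SUP_least)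
  have val: "residual b l j = (SUP u\<in>?U. u j)"
    by (simp add: residual_def)
  have lower: "r \<le> residual b l j" if "b j + r \<le> l" "r \<noteq> \<infinity>" for r
    unfolding val by (rule SUP_upper2[OF unit[OF that]]) simp
  show ?thesis
  proof (cases "j \<in> Supp b")
    case True
    then obtain c where c: "b j = ereal c" unfolding Supp_def by blast
    have "residual b l j \<le> - b j + l"
      unfolding val
    proof (rule SUP_least)
      fix u assume "u \<in> ?U"
      then have "b \<odot> u \<le> l" by simp
      moreover have "b j + u j \<le> b \<odot> u"
        unfolding trop_dot_def by (rule SUP_upper) simp
      ultimately have "b j + u j \<le> l" by (rule order_trans[rotated])
      then show "u j \<le> - b j + l" using c by (cases "u j"; cases l) auto
    qed
    moreover have "- b j + l \<le> residual b l j"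
      using l c by (intro lower; cases l) (auto simp: Rmax_iff)
    ultimately show ?thesis using True by (simp add: order_antisym)
  next
    case False
    then have "b j = -\<infinity>" using b by (simp add: Supp_iff)
    then have "ereal r \<le> residual b l j" for r by (intro lower) auto
    then have "residual b l j = \<infinity>" by (metis ereal_top)
    then show ?thesis using False by simp
  qed
qed

end

(* The projection y = x \<and> b\(ax) differs from x only on Supp b, which a does not see, so ay = ax.
   By residuation, y is then the largest h \<le> x with bh \<le> ax; it lies in H because ay = ax, and every
   h \<in> H with h \<le> x satisfies bh \<le> ah \<le> ax. *)
theory Submission
  imports Defs
begin

lemma trop_dot_mono: "h \<le> k \<Longrightarrow> a \<odot> h \<le> a \<odot> k"
  unfolding trop_dot_def by (intro SUP_mono) (auto simp: le_fun_def intro: add_left_mono)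

text \<open>Off the support, \<open>a i = -\<infinity>\<close> and
  \<open>h i \<noteq> \<infinity>\<close>, so the term is \<open>-\<infinity>\<close> and cannot
  affect the supremum. The bound on \<open>h\<close> matters because
  \<open>-\<infinity> + \<infinity> = \<infinity>\<close> in \<open>ereal\<close>.\<close>

lemma trop_dot_eq_SUP_Supp:
  assumes "a \<in> Rmax_vec" "h \<in> Rmax_vec"
  shows "a \<odot> h = (SUP i\<in>Supp a. a i + h i)"
  unfolding trop_dot_def
proof (intro antisym SUP_least)
  fix i
  show "a i + h i \<le> (SUP i\<in>Supp a. a i + h i)"
  proof (cases "i \<in> Supp a")
    case False
    then have "a i = -\<infinity>" "h i \<noteq> \<infinity>"
      using assms by (auto simp: Supp_iff Rmax_vec_def Rmax_iff)
    then show ?thesis by (cases "h i") auto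
  qed (rule SUP_upper)
qed (rule SUP_upper, simp)

text \<open>Over a finite nonempty index type the supremum is attained, and no single term is
  \<open>\<infinity>\<close>. This makes \<open>a \<odot> x\<close> an admissible scalar for
  \<open>residual_apply\<close>.\<close>

lemma trop_dot_in_Rmax:
  assumes "a \<in> Rmax_vec" "h \<in> Rmax_vec"
  shows "a \<odot> h \<in> Rmax"
proof -
  have "a \<odot> h \<in> range (\<lambda>i. a i + h i)"
    unfolding trop_dot_def by (subst cSup_eq_Max) (auto intro: Max_in)
  then show ?thesis
    using assms by (auto simp: Rmax_vec_def Rmax_iff)
qed

text \<open>The Galois connection of residuation. The residual may have entries
  \<open>\<infinity>\<close>, so the converse is checked entrywise: only indices in
  \<open>Supp b\<close> contribute, and there the residual is \<open>- b j + l\<close>.\<close>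

lemma trop_dot_le_iff_le_residual:
  assumes b: "b \<in> Rmax_vec" and h: "h \<in> Rmax_vec" and l: "l \<in> Rmax"
  shows "b \<odot> h \<le> l \<longleftrightarrow> h \<le> residual b l"
proof
  show "b \<odot> h \<le> l \<Longrightarrow> h \<le> residual b l"
    unfolding residual_def using h by (intro Sup_upper) simp
next
  assume le: "h \<le> residual b l"
  show "b \<odot> h \<le> l"
    unfolding trop_dot_eq_SUP_Supp[OF b h]
  proof (rule SUP_least)
    fix j assume j: "j \<in> Supp b"
    then obtain c where c: "b j = ereal c" unfolding Supp_def by blast
    have "h j \<le> - b j + l"
      using le_funD[OF le, of j] j by (simp add: residual_apply[OF b l])
    then show "b j + h j \<le> l"
      using c by (cases "h j"; cases l) auto
  qed
qed

lemma proj_half_space_eq_inf_residual: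
  assumes a: "a \<in> Rmax_vec" and b: "b \<in> Rmax_vec" and x: "x \<in> Rmax_vec"
    and disj: "Supp a \<inter> Supp b = {}"
  shows "proj (half_space a b) x = inf x (residual b (a \<odot> x))"
proof -
  let ?y = "inf x (residual b (a \<odot> x))"
  note l = trop_dot_in_Rmax[OF a x]
  note P = proj_half_space[OF a b x]
  \<comment> \<open>Meeting with \<open>x\<close> removes the infinite entries of the
    residual.\<close>
  have y: "?y \<in> Rmax_vec"
    using x by (auto simp: Rmax_vec_def Rmax_iff inf_min min_def)
  \<comment> \<open>By disjointness \<open>i\<close> lies outside \<open>Supp b\<close>, where the
    residual is \<open>\<infinity>\<close>.\<close>
  have "?y i = x i" if "i \<in> Supp a" for i
    using that disj by (auto simp: residual_apply[OF b l])
  then have "(SUP i\<in>Supp a. a i + ?y i) = (SUP i\<in>Supp a. a i + x i)"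
    by (intro SUP_cong) (simp_all only:)
  then have ay: "a \<odot> ?y = a \<odot> x"
    by (simp only: trop_dot_eq_SUP_Supp[OF a y, symmetric] trop_dot_eq_SUP_Supp[OF a x, symmetric])
  have "b \<odot> ?y \<le> a \<odot> x"
    using trop_dot_le_iff_le_residual[OF b y l] by simp
  then have yH: "?y \<in> half_space a b"
    unfolding half_space_def using y ay by simp
  show ?thesis
  proof (rule antisym)
    let ?p = "proj (half_space a b) x"
    have p: "?p \<in> Rmax_vec" "b \<odot> ?p \<le> a \<odot> ?p"
      using P(1) by (auto simp only: half_space_def mem_Collect_eq)
    \<comment> \<open>Replacing \<open>a \<odot> ?p\<close> by the fixed scalar
      \<open>a \<odot> x\<close> turns membership in the half-space into a bound that residuation
      can invert.\<close>
    have "b \<odot> ?p \<le> a \<odot> x"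
      using p(2) trop_dot_mono[OF P(2)] by (rule order_trans)
    then show "?p \<le> ?y"
      using trop_dot_le_iff_le_residual[OF b p(1) l] P(2) by (metis le_infI)
    show "?y \<le> ?p"
      by (rule P(3)[OF yH inf_le1])
  qed
qed

theorem theorem5p1:
  fixes a b x :: "'n::finite \<Rightarrow> ereal" and H :: "('n \<Rightarrow> ereal) set" and I J :: "'n set"
  assumes "a \<in> Rmax_vec" and "b \<in> Rmax_vec"
    and "H = half_space a b"
    and "I = Supp a" and "J = Supp b"
    and "I \<inter> J = {}" and "J \<noteq> {}"
    and "x \<in> Rmax_vec"
  shows "proj H x = inf x (residual b (a \<odot> x))
    \<and> (\<forall>j. j \<notin> J \<longrightarrow> proj H x j = x j)
    \<and> (\<forall>j\<in>J. proj H x j = min (x j) (- b j + a \<odot> x)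
          \<and> proj H x j = min (x j) (- b j + (SUP i\<in>I. a i + x i)))"
proof -
  note l = trop_dot_in_Rmax[OF assms(1,8)]
  have eq: "proj H x = inf x (residual b (a \<odot> x))"
    using proj_half_space_eq_inf_residual assms by blast
  \<comment> \<open>The value \<open>\<infinity>\<close> is neutral for \<open>min\<close>, so one
    formula covers both cases.\<close>
  then have "proj H x j = min (x j) (if j \<in> J then - b j + a \<odot> x else \<infinity>)" for j
    by (simp add: residual_apply[OF assms(2) l] assms(5) inf_min)
  moreover have "a \<odot> x = (SUP i\<in>I. a i + x i)"
    using trop_dot_eq_SUP_Supp[OF assms(1,8)] by (simp add: assms(4))
  ultimately show ?thesis
    using eq by (simp add: min_def)
qed

end
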